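(* Let $\Omega$ be a nonempty set, $Y$ a real Banach space, $\mathcal X$ a Banach subspace of $\mathcal B(\Omega,Y)$, and assume that the nonempty bounded set $M\subseteq\mathcal X$ is extendedly equicontinuous. Then $$\alpha(M)=\mu_\alpha(M).$$
   Context: $\mathcal B(\Omega,Y)$ is the Banach space of all bounded functions $f:\Omega\to Y$ with norm $\|f\|_\infty=\sup_{x\in\Omega}\|f(x)\|$. A Banach subspace of $\mathcal B(\Omega,Y)$ is a closed linear subspace equipped with $\|\cdot\|_\infty$ (possibly the whole space). For a nonempty bounded subset $M$ of a Banach space, the Kuratowski measure of noncompactness $\alpha(M)$ is the infimum of all $\varepsilon>0$ such that $M$ can be covered by finitely many sets of diameter not greater than $\varepsilon$. For $x\in\Omega$, $M(x)=\{f(x):f\in M\}\subseteq Y$, and $\mu_\alpha(M)=\sup_{x\in\Omega}\alpha(M(x))$ (with $\alpha$ taken in $Y$). A bounded set $M\subseteq\mathcal X$ is extendedly equicontinuous (with respect to $\mathcal X$) if for every $\varepsilon>0$ there are a finite partition $\{A_1,\dots,A_n\}$ of $\Omega$ and a finite set $\{\varphi_1,\dots,\varphi_m\}$ of functions in $\mathcal X$ such that for every $f\in M$ there is $j\in\{1,\dots,m\}$ with $\operatorname{diam}((f-\varphi_j)(A_i))\le\varepsilon$ for all $i=1,\dots,n$. *)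

theory Defs
  imports "HOL-Analysis.Analysis"
begin

text \<open>
  A function on the set \<open>\<Omega>\<close> is represented as an \<^const>\<open>extensional\<close> function, so that functions
  agreeing on \<open>\<Omega>\<close> are equal; the pointwise vector operations therefore have to be restricted to \<open>\<Omega>\<close>.
\<close>

definition bounded_functions :: "'a set \<Rightarrow> ('a \<Rightarrow> 'b::real_normed_vector) metric"
  where "bounded_functions \<Omega> = funspace \<Omega> euclidean_metric"

lemma mspace_bounded_functions:
  "mspace (bounded_functions \<Omega>) = {f. f \<in> extensional \<Omega> \<and> bounded (f ` \<Omega>)}"
  by (auto simp: bounded_functions_def Met_TC.fspace_def)

lemma mdist_bounded_functions:
  assumes "\<Omega> \<noteq> {}" "f \<in> mspace (bounded_functions \<Omega>)" "g \<in> mspace (bounded_functions \<Omega>)"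
  shows "mdist (bounded_functions \<Omega>) f g = (SUP x\<in>\<Omega>. norm (f x - g x))"
  using assms by (auto simp: bounded_functions_def Met_TC.fdist_def dist_norm)

definition banach_subspace :: "'a set \<Rightarrow> ('a \<Rightarrow> 'b::real_normed_vector) set \<Rightarrow> bool"
  where "banach_subspace \<Omega> X \<longleftrightarrow>
    X \<subseteq> mspace (bounded_functions \<Omega>) \<and>
    (\<lambda>x\<in>\<Omega>. 0) \<in> X \<and>
    (\<forall>f\<in>X. \<forall>g\<in>X. (\<lambda>x\<in>\<Omega>. f x + g x) \<in> X) \<and>
    (\<forall>c. \<forall>f\<in>X. (\<lambda>x\<in>\<Omega>. c *\<^sub>R f x) \<in> X) \<and>
    closedin (mtopology_of (bounded_functions \<Omega>)) X"

lemma banach_subspace_complete: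
  fixes X :: "('a \<Rightarrow> 'b::banach) set"
  assumes "banach_subspace \<Omega> X"
  shows "mcomplete_of (submetric (bounded_functions \<Omega>) X)"
proof -
  have "mcomplete_of (bounded_functions \<Omega> :: ('a \<Rightarrow> 'b) metric)"
    unfolding bounded_functions_def
    using Met_TC.mcomplete_funspace[where ?'a = 'b and S = \<Omega>] complete_UNIV
    by (simp add: mcomplete_of_def)
  moreover have X: "X \<subseteq> mspace (bounded_functions \<Omega>)"
    and "closedin (mtopology_of (bounded_functions \<Omega>)) X"
    using assms by (auto simp: banach_subspace_def)
  moreover have "Submetric (mspace (bounded_functions \<Omega>)) (mdist (bounded_functions \<Omega>)) X"
    using X by (simp add: Submetric_def Submetric_axioms_def)
  ultimately have "Metric_space.mcomplete X (mdist (bounded_functions \<Omega>))"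
    unfolding mcomplete_of_def mtopology_of_def
    by (metis Submetric.closedin_mcomplete_imp_mcomplete)
  moreover have "mspace (submetric (bounded_functions \<Omega>) X) = X"
    using X unfolding mspace_submetric by blast
  ultimately show ?thesis
    by (simp only: mcomplete_of_def mdist_submetric)
qed

definition mbounded_of :: "'a metric \<Rightarrow> 'a set \<Rightarrow> bool"
  where "mbounded_of m = Metric_space.mbounded (mspace m) (mdist m)"

text \<open>Extended-valued, because \<^const>\<open>diameter\<close> has no meaningful value on unbounded sets.\<close>

definition mdiam :: "'a metric \<Rightarrow> 'a set \<Rightarrow> ennreal"
  where "mdiam m S = (SUP x\<in>S. SUP y\<in>S. ennreal (mdist m x y))"

lemma mdiam_euclidean:
  assumes "bounded S"
  shows "mdiam euclidean_metric S = ennreal (diameter S)"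
proof (cases "S = {}")
  case False
  show ?thesis
  proof (rule antisym)
    show "mdiam euclidean_metric S \<le> ennreal (diameter S)"
      unfolding mdiam_def
      by (intro SUP_least) (auto intro!: ennreal_leI diameter_bounded_bound assms)
    have "diameter S \<le> b" if b: "mdiam euclidean_metric S = ennreal b" "0 \<le> b" for b
    proof -
      have "ennreal (dist x y) \<le> ennreal b" if "x \<in> S" "y \<in> S" for x y
        unfolding b(1)[symmetric] mdiam_def
        using that by (intro SUP_upper2[of x S] SUP_upper2[of y S]) auto
      then show ?thesis
        using False b(2) by (auto simp: diameter_def intro!: cSUP_least)
    qed
    then show "ennreal (diameter S) \<le> mdiam euclidean_metric S"
      by (cases "mdiam euclidean_metric S") (auto simp: ennreal_leI)
  qed
qed (simp add: mdiam_def bot_ennreal)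

definition kuratowski :: "'a metric \<Rightarrow> 'a set \<Rightarrow> real"
  where "kuratowski m S = Inf {\<epsilon>. 0 < \<epsilon> \<and>
    (\<exists>C. finite C \<and> S \<subseteq> \<Union>C \<and> (\<forall>T\<in>C. T \<subseteq> mspace m \<and> mdiam m T \<le> ennreal \<epsilon>))}"

definition mu_alpha :: "'a set \<Rightarrow> ('a \<Rightarrow> 'b::real_normed_vector) set \<Rightarrow> real"
  where "mu_alpha \<Omega> M = (SUP x\<in>\<Omega>. kuratowski euclidean_metric ((\<lambda>f. f x) ` M))"

text \<open>
  The library's \<^const>\<open>diameter\<close> is adequate here: \<open>f - \<phi>\<close> is bounded on \<open>A \<subseteq> \<Omega>\<close>.
\<close>

definition extendedly_equicontinuous ::
    "'a set \<Rightarrow> ('a \<Rightarrow> 'b::real_normed_vector) set \<Rightarrow> ('a \<Rightarrow> 'b) set \<Rightarrow> bool"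
  where "extendedly_equicontinuous \<Omega> X M \<longleftrightarrow>
    (\<forall>\<epsilon>>0. \<exists>P \<Phi>. finite P \<and> partition_on \<Omega> P \<and> finite \<Phi> \<and> \<Phi> \<subseteq> X \<and>
      (\<forall>f\<in>M. \<exists>\<phi>\<in>\<Phi>. \<forall>A\<in>P. diameter ((\<lambda>x. f x - \<phi> x) ` A) \<le> \<epsilon>))"

end

theory Submission
  imports Defs
begin

text \<open>
  Evaluation at a point is nonexpansive, so covers of \<open>M\<close> project to covers of each \<open>M(x)\<close>.
  Conversely, pick one point in every part of the partition given by extended equicontinuity and
  sort the functions \<open>f\<close> in \<open>M\<close> by the function \<open>\<phi>\<close> that approximates \<open>f\<close> and by the members of
  small covers that contain the values of \<open>f\<close> at the chosen points. This gives finitely many classes,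
  and the triangle inequality through the chosen points bounds their diameters.
\<close>

lemma mbounded_of_iff:
  "mbounded_of m S \<longleftrightarrow> S \<subseteq> mspace m \<and> (\<exists>B>0. \<forall>x\<in>S. \<forall>y\<in>S. mdist m x y \<le> B)"
  unfolding mbounded_of_def by (rule Metric_space.mbounded_alt_pos) simp

text \<open>Passes from extended-valued diameters to real bounds on pairs of points, so that later
  arguments never meet \<open>ennreal\<close>.\<close>

lemma mdiam_le_iff:
  "0 \<le> e \<Longrightarrow> mdiam m S \<le> ennreal e \<longleftrightarrow> (\<forall>x\<in>S. \<forall>y\<in>S. mdist m x y \<le> e)"
  unfolding mdiam_def by (simp add: SUP_le_iff)

lemma kuratowski_le:
  assumes "0 < e" "finite C" "S \<subseteq> \<Union>C"
    and "\<And>T. T \<in> C \<Longrightarrow> T \<subseteq> mspace m"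
    and "\<And>T x y. T \<in> C \<Longrightarrow> x \<in> T \<Longrightarrow> y \<in> T \<Longrightarrow> mdist m x y \<le> e"
  shows "kuratowski m S \<le> e"
  unfolding kuratowski_def
proof (rule cInf_lower)
  show "bdd_below {\<epsilon>. 0 < \<epsilon> \<and>
    (\<exists>C. finite C \<and> S \<subseteq> \<Union>C \<and> (\<forall>T\<in>C. T \<subseteq> mspace m \<and> mdiam m T \<le> ennreal \<epsilon>))}"
    by (rule bdd_belowI[of _ 0]) auto
  have "\<forall>T\<in>C. T \<subseteq> mspace m \<and> mdiam m T \<le> ennreal e"
    using assms by (simp add: mdiam_le_iff)
  then show "e \<in> {\<epsilon>. 0 < \<epsilon> \<and>
    (\<exists>C. finite C \<and> S \<subseteq> \<Union>C \<and> (\<forall>T\<in>C. T \<subseteq> mspace m \<and> mdiam m T \<le> ennreal \<epsilon>))}"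
    using assms(1-3) by blast
qed

text \<open>Boundedness of \<open>S\<close> makes the set of admissible radii nonempty, so its
  infimum is meaningful and some radius in it lies below \<open>e\<close>. The cover for that
  smaller radius also serves for \<open>e\<close>.\<close>

lemma kuratowski_less_cover:
  assumes "mbounded_of m S" "kuratowski m S < e"
  obtains C where "0 < e" "finite C" "S \<subseteq> \<Union>C"
    "\<And>T. T \<in> C \<Longrightarrow> T \<subseteq> mspace m"
    "\<And>T x y. T \<in> C \<Longrightarrow> x \<in> T \<Longrightarrow> y \<in> T \<Longrightarrow> mdist m x y \<le> e"
proof -
  define E where "E = {\<epsilon>. 0 < \<epsilon> \<and>
    (\<exists>C. finite C \<and> S \<subseteq> \<Union>C \<and> (\<forall>T\<in>C. T \<subseteq> mspace m \<and> mdiam m T \<le> ennreal \<epsilon>))}"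
  obtain B where "0 < B" "\<forall>x\<in>S. \<forall>y\<in>S. mdist m x y \<le> B" "S \<subseteq> mspace m"
    using assms(1) by (auto simp: mbounded_of_iff)
  \<comment> \<open>The one-element cover \<open>{S}\<close> shows that the bound \<open>B\<close>
    is admissible; it was taken positive because radii in \<open>E\<close> are.\<close>
  then have "B \<in> E"
    by (auto simp: E_def mdiam_le_iff intro!: exI[of _ "{S}"])
  then have "E \<noteq> {}" by blast
  moreover have "Inf E < e"
    using assms(2) unfolding kuratowski_def E_def .
  ultimately obtain d where "d \<in> E" "d < e"
    using cInf_lessD by blast
  then obtain C where d: "0 < d" "d < e" and C: "finite C" "S \<subseteq> \<Union>C"
    "\<forall>T\<in>C. T \<subseteq> mspace m \<and> (\<forall>x\<in>T. \<forall>y\<in>T. mdist m x y \<le> d)"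
    by (auto simp: E_def mdiam_le_iff)
  show thesis
  proof (rule that[of C])
    show "mdist m x y \<le> e" if "T \<in> C" "x \<in> T" "y \<in> T" for T x y
      using C(3) that d by fastforce
  qed (use C d in auto)
qed

text \<open>The images under \<open>h\<close> of the members of a cover form a cover that is at
  least as fine. Nonexpansiveness is asked on all of \<open>mspace m\<close>, since members of a
  cover may contain points outside \<open>S\<close>.\<close>

lemma kuratowski_image_le:
  assumes "mbounded_of m S" "h \<in> mspace m \<rightarrow> mspace m'"
    and lip: "\<And>x y. x \<in> mspace m \<Longrightarrow> y \<in> mspace m \<Longrightarrow> mdist m' (h x) (h y) \<le> mdist m x y"
  shows "kuratowski m' (h ` S) \<le> kuratowski m S"
proof (rule dense_ge)
  fix e assume "kuratowski m S < e"
  then obtain C where C: "0 < e" "finite C" "S \<subseteq> \<Union>C"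
    "\<And>T. T \<in> C \<Longrightarrow> T \<subseteq> mspace m"
    "\<And>T x y. T \<in> C \<Longrightarrow> x \<in> T \<Longrightarrow> y \<in> T \<Longrightarrow> mdist m x y \<le> e"
    using kuratowski_less_cover[OF assms(1)] by metis
  show "kuratowski m' (h ` S) \<le> e"
  proof (rule kuratowski_le[where C = "(`) h ` C"])
    show "mdist m' u v \<le> e" if T: "T \<in> (`) h ` C" "u \<in> T" "v \<in> T" for T u v
    proof -
      obtain T' x y where T': "T' \<in> C" "x \<in> T'" "y \<in> T'" "u = h x" "v = h y"
        using T by blast
      then have "x \<in> mspace m" "y \<in> mspace m" using C(4) by blast+
      then show ?thesis using lip C(5) T' by (metis order_trans)
    qed
    show "T \<subseteq> mspace m'" if "T \<in> (`) h ` C" for T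
      using that C(4) assms(2) by fast
  qed (use C(1-3) in auto)
qed

lemma mbounded_of_image:
  assumes "mbounded_of m S" "h \<in> mspace m \<rightarrow> mspace m'"
    and "\<And>x y. x \<in> mspace m \<Longrightarrow> y \<in> mspace m \<Longrightarrow> mdist m' (h x) (h y) \<le> mdist m x y"
  shows "mbounded_of m' (h ` S)"
proof -
  obtain B where B: "S \<subseteq> mspace m" "0 < B" "\<And>x y. x \<in> S \<Longrightarrow> y \<in> S \<Longrightarrow> mdist m x y \<le> B"
    using assms(1) by (auto simp: mbounded_of_iff)
  have "mdist m' (h x) (h y) \<le> B" if "x \<in> S" "y \<in> S" for x y
    using assms(3)[of x y] B that by fastforce
  then show ?thesis
    using assms(2) B by (auto simp: mbounded_of_iff)
qed

lemma mbounded_of_submetric: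
  "mbounded_of m S \<Longrightarrow> S \<subseteq> X \<Longrightarrow> mbounded_of (submetric m X) S"
  by (auto simp: mbounded_of_iff mspace_submetric)

text \<open>This is the nonexpansiveness of evaluation at \<open>x\<close>. Boundedness of
  \<open>f\<close> and \<open>g\<close> keeps the supremum from being taken over an unbounded
  set.\<close>

lemma norm_diff_le_mdist_bounded_functions:
  assumes "f \<in> mspace (bounded_functions \<Omega>)" "g \<in> mspace (bounded_functions \<Omega>)" "x \<in> \<Omega>"
  shows "norm (f x - g x) \<le> mdist (bounded_functions \<Omega>) f g"
proof -
  have "bounded ((\<lambda>x. f x - g x) ` \<Omega>)"
    using assms by (intro bounded_minus_comp) (auto simp: mspace_bounded_functions)
  then have "bdd_above ((\<lambda>x. norm (f x - g x)) ` \<Omega>)"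
    by (auto simp: bounded_iff bdd_above_def)
  then have "norm (f x - g x) \<le> (SUP x\<in>\<Omega>. norm (f x - g x))"
    using assms(3) by (rule cSUP_upper2) simp
  then show ?thesis
    using assms by (subst mdist_bounded_functions) auto
qed

lemma norm_diff_le_diameter:
  fixes f g :: "'a \<Rightarrow> 'b::real_normed_vector"
  assumes "f \<in> mspace (bounded_functions \<Omega>)" "g \<in> mspace (bounded_functions \<Omega>)"
    and "A \<subseteq> \<Omega>" "x \<in> A" "y \<in> A"
  shows "norm ((f x - g x) - (f y - g y)) \<le> diameter ((\<lambda>x. f x - g x) ` A)"
proof -
  have "bounded (f ` A)" "bounded (g ` A)"
    using assms(1-3) by (auto simp: mspace_bounded_functions intro: bounded_subset)
  then have "bounded ((\<lambda>x. f x - g x) ` A)"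
    by (intro bounded_minus_comp)
  then show ?thesis
    unfolding dist_norm[symmetric] using assms(4,5) by (intro diameter_bounded_bound) auto
qed

text \<open>Primed letters stand for values at the chosen point of a part, the others for values at
  another point of that part. The terms in \<open>p\<close> and \<open>p'\<close> cancel because
  \<open>f\<close> and \<open>g\<close> share one approximating function.\<close>

lemma norm_diff_via_approximation:
  fixes f g p f' g' p' :: "'b::real_normed_vector"
  assumes "norm ((f - p) - (f' - p')) \<le> e" "norm ((g - p) - (g' - p')) \<le> e"
    and "norm (f' - g') \<le> d"
  shows "norm (f - g) \<le> d + 2 * e"
proof -
  have "f - g = (f' - g') + (((f - p) - (f' - p')) - ((g - p) - (g' - p')))"
    by simp
  also have "norm \<dots> \<le> d + (e + e)"
    by (intro norm_triangle_mono norm_triangle_le_diff add_mono assms order_trans[OF norm_triangle_ineq4])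
  finally show ?thesis by simp
qed

text \<open>The hard inequality, up to an error. The strict bound by \<open>d\<close>, uniform in
  \<open>x\<close>, provides at each point of \<Omega> a finite cover with sets of diameter at most
  \<open>d\<close>; equicontinuity contributes \<open>e\<close> for each of the two functions
  compared.\<close>

lemma kuratowski_le_of_extendedly_equicontinuous:
  fixes M X :: "('a \<Rightarrow> 'b::real_normed_vector) set"
  assumes "\<Omega> \<noteq> {}" "X \<subseteq> mspace (bounded_functions \<Omega>)" "M \<subseteq> X"
    and "extendedly_equicontinuous \<Omega> X M"
    and bdd: "\<And>x. x \<in> \<Omega> \<Longrightarrow> mbounded_of euclidean_metric ((\<lambda>f. f x) ` M)"
    and less: "\<And>x. x \<in> \<Omega> \<Longrightarrow> kuratowski euclidean_metric ((\<lambda>f. f x) ` M) < d"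
    and "0 < e"
  shows "kuratowski (submetric (bounded_functions \<Omega>) X) M \<le> d + 2 * e"
proof -
  obtain P \<Phi> where P: "finite P" "partition_on \<Omega> P" and \<Phi>: "finite \<Phi>" "\<Phi> \<subseteq> X"
    and approx: "\<And>f. f \<in> M \<Longrightarrow> \<exists>\<phi>\<in>\<Phi>. \<forall>A\<in>P. diameter ((\<lambda>x. f x - \<phi> x) ` A) \<le> e"
    using assms(4) \<open>0 < e\<close> unfolding extendedly_equicontinuous_def by meson
  \<comment> \<open>Parts of a partition are nonempty, so the choice really yields a point of
    \<open>A\<close>.\<close>
  define pt where "pt A = (SOME x. x \<in> A)" for A :: "'a set"
  have pt: "pt A \<in> A" if "A \<in> P" for A
    using that P(2) unfolding pt_def partition_on_def by (metis some_in_eq)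
  have sub: "A \<subseteq> \<Omega>" if "A \<in> P" for A
    using that P(2) by (auto simp: partition_on_def)
  have "\<exists>C. finite C \<and> (\<lambda>f. f x) ` M \<subseteq> \<Union>C \<and> 0 < d \<and>
      (\<forall>T\<in>C. \<forall>u\<in>T. \<forall>v\<in>T. dist u v \<le> d)" if "x \<in> \<Omega>" for x
    by (rule kuratowski_less_cover[OF bdd[OF that] less[OF that]]) (metis mdist_euclidean_metric)
  then obtain C where C: "\<And>x. x \<in> \<Omega> \<Longrightarrow> finite (C x)"
      "\<And>x. x \<in> \<Omega> \<Longrightarrow> (\<lambda>f. f x) ` M \<subseteq> \<Union>(C x)"
      "\<And>x T u v. x \<in> \<Omega> \<Longrightarrow> T \<in> C x \<Longrightarrow> u \<in> T \<Longrightarrow> v \<in> T \<Longrightarrow> dist u v \<le> d"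
    and "0 < d"
    using \<open>\<Omega> \<noteq> {}\<close> by (metis ex_in_conv)
  \<comment> \<open>The classes of the sorting: \<open>\<phi>\<close> records the approximating
    function, and \<open>s\<close> selects for each part a cover member containing the value at its
    chosen point. Classes may overlap, as only covering matters.\<close>
  define K where "K \<phi> s = {f \<in> M. \<forall>A\<in>P. diameter ((\<lambda>x. f x - \<phi> x) ` A) \<le> e \<and> f (pt A) \<in> s A}"
    for \<phi> :: "'a \<Rightarrow> 'b" and s
  \<comment> \<open>Extensional choice functions on the finite set \<open>P\<close>, with finite
    sets of values, are finite in number.\<close>
  let ?S = "Pi\<^sub>E P (\<lambda>A. C (pt A))"
  show ?thesis
  proof (rule kuratowski_le[where C = "(\<lambda>(\<phi>, s). K \<phi> s) ` (\<Phi> \<times> ?S)"])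
    show "0 < d + 2 * e" using \<open>0 < d\<close> \<open>0 < e\<close> by simp
    have "finite ?S"
      using P(1) C(1) pt sub by (intro finite_PiE) blast+
    then show "finite ((\<lambda>(\<phi>, s). K \<phi> s) ` (\<Phi> \<times> ?S))"
      using \<Phi>(1) by blast
    show "M \<subseteq> \<Union> ((\<lambda>(\<phi>, s). K \<phi> s) ` (\<Phi> \<times> ?S))"
    proof
      fix f assume f: "f \<in> M"
      obtain \<phi> where \<phi>: "\<phi> \<in> \<Phi>" "\<forall>A\<in>P. diameter ((\<lambda>x. f x - \<phi> x) ` A) \<le> e"
        using approx[OF f] by blast
      have "\<forall>A\<in>P. \<exists>T\<in>C (pt A). f (pt A) \<in> T"
        using C(2) f pt sub by blast
      then obtain s where s: "\<forall>A\<in>P. s A \<in> C (pt A) \<and> f (pt A) \<in> s A"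
        by metis
      \<comment> \<open>Restricting \<open>s\<close> makes it extensional and leaves the class
        unchanged, since \<open>K\<close> looks at \<open>s\<close> only on
        \<open>P\<close>.\<close>
      have "restrict s P \<in> ?S" "f \<in> K \<phi> (restrict s P)"
        using s f \<phi> by (auto simp: K_def)
      then show "f \<in> \<Union> ((\<lambda>(\<phi>, s). K \<phi> s) ` (\<Phi> \<times> ?S))"
        using \<phi>(1) by blast
    qed
    show "T \<subseteq> mspace (submetric (bounded_functions \<Omega>) X)"
      if "T \<in> (\<lambda>(\<phi>, s). K \<phi> s) ` (\<Phi> \<times> ?S)" for T
      using that assms(2,3) by (auto simp: K_def mspace_submetric)
    show "mdist (submetric (bounded_functions \<Omega>) X) f g \<le> d + 2 * e"
      if T: "T \<in> (\<lambda>(\<phi>, s). K \<phi> s) ` (\<Phi> \<times> ?S)" "f \<in> T" "g \<in> T" for T f g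
    proof -
      obtain \<phi> s where \<phi>: "\<phi> \<in> \<Phi>" and s: "s \<in> ?S" and fg: "f \<in> K \<phi> s" "g \<in> K \<phi> s"
        using T by auto
      have mem: "f \<in> mspace (bounded_functions \<Omega>)" "g \<in> mspace (bounded_functions \<Omega>)"
        "\<phi> \<in> mspace (bounded_functions \<Omega>)"
        using fg \<phi> \<Phi>(2) assms(2,3) by (auto simp: K_def)
      have "norm (f x - g x) \<le> d + 2 * e" if x: "x \<in> \<Omega>" for x
      proof -
        obtain A where A: "A \<in> P" "x \<in> A"
          using x P(2) unfolding partition_on_def by blast
        show ?thesis
        proof (rule norm_diff_via_approximation)
          show "norm ((f x - \<phi> x) - (f (pt A) - \<phi> (pt A))) \<le> e"
            using norm_diff_le_diameter[OF mem(1,3) sub[OF A(1)] A(2) pt[OF A(1)]] fg(1) A(1)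
            by (force simp: K_def)
          show "norm ((g x - \<phi> x) - (g (pt A) - \<phi> (pt A))) \<le> e"
            using norm_diff_le_diameter[OF mem(2,3) sub[OF A(1)] A(2) pt[OF A(1)]] fg(2) A(1)
            by (force simp: K_def)
          have "s A \<in> C (pt A)" "f (pt A) \<in> s A" "g (pt A) \<in> s A" "pt A \<in> \<Omega>"
            using s A(1) fg pt sub by (auto simp: K_def)
          then show "norm (f (pt A) - g (pt A)) \<le> d"
            using C(3) by (metis dist_norm)
        qed
      qed
      then show ?thesis
        using \<open>\<Omega> \<noteq> {}\<close> mem by (simp add: mdist_bounded_functions cSUP_least)
    qed
  qed
qed

theorem corollary3p2:
  fixes \<Omega> :: "'a set" and X M :: "('a \<Rightarrow> 'b::banach) set"
  assumes "\<Omega> \<noteq> {}"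
    and "banach_subspace \<Omega> X"
    and "M \<subseteq> X" and "M \<noteq> {}"
    and "mbounded_of (bounded_functions \<Omega>) M"
    and "extendedly_equicontinuous \<Omega> X M"
  shows "kuratowski (submetric (bounded_functions \<Omega>) X) M = mu_alpha \<Omega> M"
proof -
  let ?m = "submetric (bounded_functions \<Omega>) X"
  let ?k = "\<lambda>x. kuratowski euclidean_metric ((\<lambda>f. f x) ` M)"
  have X: "X \<subseteq> mspace (bounded_functions \<Omega>)"
    using assms(2) by (simp add: banach_subspace_def)
  have bM: "mbounded_of ?m M"
    using assms(3,5) by (simp add: mbounded_of_submetric)
  have lip: "mdist euclidean_metric (f x) (g x) \<le> mdist ?m f g"
    if "x \<in> \<Omega>" "f \<in> mspace ?m" "g \<in> mspace ?m" for x f g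
    using that norm_diff_le_mdist_bounded_functions by (auto simp: mspace_submetric dist_norm)
  have bdd: "mbounded_of euclidean_metric ((\<lambda>f. f x) ` M)" if "x \<in> \<Omega>" for x
    by (rule mbounded_of_image[OF bM]) (use lip that in auto)
  have le: "?k x \<le> kuratowski ?m M" if "x \<in> \<Omega>" for x
    by (rule kuratowski_image_le[OF bM]) (use lip that in auto)
  have "mu_alpha \<Omega> M \<le> kuratowski ?m M"
    unfolding mu_alpha_def using assms(1) le by (rule cSUP_least)
  moreover have "kuratowski ?m M \<le> mu_alpha \<Omega> M"
  proof (rule field_le_epsilon)
    fix e :: real assume "0 < e"
    \<comment> \<open>The easy inequality is used again here: it bounds the family of pointwise
      measures, so that each of them lies below the supremum
      \<open>mu_alpha \<Omega> M\<close>.\<close>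
    have "bdd_above (?k ` \<Omega>)"
      using le by (rule bdd_aboveI2)
    then have "?k x < mu_alpha \<Omega> M + e / 3" if "x \<in> \<Omega>" for x
      using cSUP_upper[of x \<Omega> ?k] that \<open>0 < e\<close> unfolding mu_alpha_def by fastforce
    \<comment> \<open>One third of \<open>e\<close> gives the strict bound at every point; the other
      two thirds pay for the two approximation errors.\<close>
    then have "kuratowski ?m M \<le> (mu_alpha \<Omega> M + e / 3) + 2 * (e / 3)"
      using \<open>0 < e\<close> by (intro kuratowski_le_of_extendedly_equicontinuous assms(1,3,6) X bdd) auto
    then show "kuratowski ?m M \<le> mu_alpha \<Omega> M + e" by simp
  qed
  ultimately show ?thesis by simp
qed

end
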